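(* Let $n\ge 3$. Let $(X,g)$ be an $n$-dimensional smooth connected Riemannian manifold without boundary, with intrinsic metric $\rho_X$. For an $n$-dimensional compact connected $C^0$-submanifold $Y\subset X$ with nonempty boundary $\partial Y$ consider the conditions: (i) $\rho_Y(x,y)<\infty$ for all $x,y\in Y$; (ii) $\rho_Y$ is a metric on $Y$; (iii) for any two points $a,b\in Y$ there exist points $c,d\in\partial Y$ which can be joined in $Y$ by a shortest path $\gamma:[0,1]\to Y$ in the metric $\rho_Y$ such that $a,b\in\gamma([0,1])$. Let $Y_1$ and $Y_2$ be $n$-dimensional compact connected $C^0$-submanifolds of $X$ with nonempty boundaries $\partial Y_1$ and $\partial Y_2$, each satisfying (i), (ii) and (iii). Assume that $Y_1$ is strictly convex in the metric $\rho_{Y_1}$; that $X$ has the property that $\rho_X(x,y)=\rho_Y(x,y)$ for any two points $x$ and $y$ in every $n$-dimensional compact connected $C^0$-submanifold $Y\subset X$ with $\partial Y\neq\varnothing$ satisfying (i)--(iii) and strictly convex with respect to $\rho_Y$; and that $\partial Y_1$ and $\partial Y_2$ are isometric with respect to the metrics $\rho_{Y_j}$, $j=1,2$, i.e. there is a bijection $f:\partial Y_1\to\partial Y_2$ with $\rho_{Y_2}(f(x),f(y))=\rho_{Y_1}(x,y)$ for all $x,y\in\partial Y_1$. Then $\partial Y_1$ and $\partial Y_2$ are isometric with respect to $\rho_X$, i.e. there is a bijection $F:\partial Y_1\to\partial Y_2$ with $\rho_X(F(x),F(y))=\rho_X(x,y)$ for all $x,y\in\partial Y_1$.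
   Context: A $C^0$-submanifold with boundary of dimension $n=\dim X$ in $X$ is a subset of $X$ which, with the subspace topology, is a topological $n$-manifold with boundary. $\mathrm{Int}\,Y$ and $\partial Y$ denote its interior and boundary. $l$ denotes length with respect to $g$. $\rho_X(x,y)$ is the infimum of the lengths $l(\gamma)$ of smooth paths $\gamma:[0,1]\to X$ joining $x$ and $y$. For an $n$-dimensional compact connected $C^0$-submanifold $Y\subset X$ with nonempty boundary $\partial Y$ and $x,y\in Y$, $$\rho_Y(x,y)=\liminf_{x'\to x,\; y'\to y;\; x',y'\in \mathrm{Int}\,Y}\ \inf\{\, l(\gamma)\,\},$$ the infimum being over all smooth paths $\gamma:[0,1]\to\mathrm{Int}\,Y$ joining $x'$ to $y'$. All paths are assumed continuous and non-constant. A shortest path in the metric $\rho_Y$ between points $\alpha\ne\beta$ of $Y$ is a path $\gamma:[0,1]\to Y$ with $\gamma(0)=\alpha$, $\gamma(1)=\beta$ for which there is a strictly increasing continuous function $\varphi:[0,1]\to[0,\infty)$ with $\varphi(0)=0$ such that $\rho_Y(\gamma(s),\gamma(t))=\varphi(t)-\varphi(s)$ for all $0\le s\le t\le 1$. $Y$ is called strictly convex in the metric $\rho_Y$ if, for any $\alpha,\beta\in Y$, any shortest path $\gamma:[0,1]\to Y$ between $\alpha$ and $\beta$ (in the metric $\rho_Y$) satisfies $\gamma(]0,1[)\subset\mathrm{Int}\,Y$. *)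

theory Defs
  imports "HOL-Analysis.Analysis"
begin

section \<open>Smooth functions between Euclidean spaces\<close>

text \<open>\<open>Ck_on k U f\<close> is meant for open \<open>U\<close>: \<open>f\<close> is \<open>k\<close> times continuously differentiable on \<open>U\<close>,
  expressed through iterated directional derivatives.\<close>

primrec Ck_on :: "nat \<Rightarrow> 'a::euclidean_space set \<Rightarrow> ('a \<Rightarrow> 'b::euclidean_space) \<Rightarrow> bool" where
  "Ck_on 0 U f \<longleftrightarrow> continuous_on U f"
| "Ck_on (Suc k) U f \<longleftrightarrow>
     (\<forall>x\<in>U. f differentiable (at x)) \<and>
     (\<forall>v. Ck_on k U (\<lambda>x. frechet_derivative f (at x) v))"

text \<open>Smoothness on an arbitrary set, e.g. on a relatively open subset of \<open>[0,1]\<close>: locally \<open>f\<close> has a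
  smooth extension to an open set. For open \<open>S\<close> this is ordinary smoothness.\<close>

definition smooth_on :: "'a::euclidean_space set \<Rightarrow> ('a \<Rightarrow> 'b::euclidean_space) \<Rightarrow> bool" where
  "smooth_on S f \<longleftrightarrow>
     (\<forall>x\<in>S. \<exists>U h. open U \<and> x \<in> U \<and> (\<forall>k. Ck_on k U h) \<and> (\<forall>y\<in>S \<inter> U. f y = h y))"


section \<open>Riemannian manifolds\<close>

text \<open>A chart is a pair of its domain and its coordinate map; the values of the coordinate map
  outside the domain are irrelevant. The dimension of the manifold is \<open>CARD('n)\<close>.\<close>

type_synonym ('a, 'n) chart = "'a set \<times> ('a \<Rightarrow> real ^ 'n)"

definition chart_image :: "('a, 'n::finite) chart \<Rightarrow> (real ^ 'n) set" where
  "chart_image c = snd c ` fst c"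

definition chart_inv :: "('a, 'n::finite) chart \<Rightarrow> real ^ 'n \<Rightarrow> 'a" where
  "chart_inv c = inv_into (fst c) (snd c)"

definition transition :: "('a, 'n::finite) chart \<Rightarrow> ('a, 'n) chart \<Rightarrow> real ^ 'n \<Rightarrow> real ^ 'n" where
  "transition c d = snd d \<circ> chart_inv c"

definition smooth_manifold :: "'a topology \<Rightarrow> ('a, 'n::finite) chart set \<Rightarrow> bool" where
  "smooth_manifold X A \<longleftrightarrow>
     Hausdorff_space X \<and> second_countable X \<and>
     (\<Union>c\<in>A. fst c) = topspace X \<and>
     (\<forall>c\<in>A. openin X (fst c) \<and> open (chart_image c) \<and>
        homeomorphic_map (subtopology X (fst c)) (top_of_set (chart_image c)) (snd c)) \<and>
     (\<forall>c\<in>A. \<forall>d\<in>A. smooth_on (snd c ` (fst c \<inter> fst d)) (transition c d))"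

text \<open>A Riemannian metric is given by its components: \<open>g c p v w\<close> is the inner product of the two
  tangent vectors at \<open>p\<close> whose coordinate vectors in the chart \<open>c\<close> are \<open>v\<close> and \<open>w\<close>. The last
  conjunct is the transformation law of a covariant 2-tensor.\<close>

type_synonym ('a, 'n) metric_tensor =
  "('a, 'n) chart \<Rightarrow> 'a \<Rightarrow> real ^ 'n \<Rightarrow> real ^ 'n \<Rightarrow> real"

definition riemannian_metric ::
    "('a, 'n::finite) chart set \<Rightarrow> ('a, 'n) metric_tensor \<Rightarrow> bool" where
  "riemannian_metric A g \<longleftrightarrow>
     (\<forall>c\<in>A. \<forall>p\<in>fst c. bilinear (g c p) \<and>
        (\<forall>v w. g c p v w = g c p w v) \<and> (\<forall>v. v \<noteq> 0 \<longrightarrow> g c p v v > 0)) \<and>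
     (\<forall>c\<in>A. \<forall>v w. smooth_on (chart_image c) (\<lambda>x. g c (chart_inv c x) v w)) \<and>
     (\<forall>c\<in>A. \<forall>d\<in>A. \<forall>p\<in>fst c \<inter> fst d. \<forall>v w.
        g c p v w = g d p (frechet_derivative (transition c d) (at (snd c p)) v)
                          (frechet_derivative (transition c d) (at (snd c p)) w))"

definition riemannian_manifold ::
    "'a topology \<Rightarrow> ('a, 'n::finite) chart set \<Rightarrow> ('a, 'n) metric_tensor \<Rightarrow> bool" where
  "riemannian_manifold X A g \<longleftrightarrow> smooth_manifold X A \<and> riemannian_metric A g"


section \<open>Smooth paths and their lengths\<close>

definition smooth_path ::
    "'a topology \<Rightarrow> ('a, 'n::finite) chart set \<Rightarrow> (real \<Rightarrow> 'a) \<Rightarrow> bool" where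
  "smooth_path X A \<gamma> \<longleftrightarrow>
     pathin X \<gamma> \<and> \<not> \<gamma> constant_on {0..1} \<and>
     (\<forall>c\<in>A. smooth_on {t\<in>{0..1}. \<gamma> t \<in> fst c} (snd c \<circ> \<gamma>))"

text \<open>The speed is computed in an arbitrary chart around \<open>\<gamma> t\<close>; by the transformation law it does not
  depend on the choice.\<close>

definition speed ::
    "('a, 'n::finite) chart set \<Rightarrow> ('a, 'n) metric_tensor \<Rightarrow> (real \<Rightarrow> 'a) \<Rightarrow> real \<Rightarrow> real" where
  "speed A g \<gamma> t =
     (let c = (SOME c. c \<in> A \<and> \<gamma> t \<in> fst c);
          v = vector_derivative (snd c \<circ> \<gamma>) (at t within {0..1})
      in sqrt (g c (\<gamma> t) v v))"

definition path_len ::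
    "('a, 'n::finite) chart set \<Rightarrow> ('a, 'n) metric_tensor \<Rightarrow> (real \<Rightarrow> 'a) \<Rightarrow> real" where
  "path_len A g \<gamma> = integral {0..1} (speed A g \<gamma>)"

text \<open>The infimum is \<open>\<infinity>\<close> if no such path exists.\<close>

definition inf_len ::
    "'a topology \<Rightarrow> ('a, 'n::finite) chart set \<Rightarrow> ('a, 'n) metric_tensor \<Rightarrow> 'a set \<Rightarrow> 'a \<Rightarrow> 'a \<Rightarrow> ereal" where
  "inf_len X A g S x y =
     (INF \<gamma>\<in>{\<gamma>. smooth_path X A \<gamma> \<and> \<gamma> ` {0..1} \<subseteq> S \<and> \<gamma> 0 = x \<and> \<gamma> 1 = y}. ereal (path_len A g \<gamma>))"

definition rho_X ::
    "'a topology \<Rightarrow> ('a, 'n::finite) chart set \<Rightarrow> ('a, 'n) metric_tensor \<Rightarrow> 'a \<Rightarrow> 'a \<Rightarrow> ereal" where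
  "rho_X X A g = inf_len X A g (topspace X)"


section \<open>Topological manifolds with boundary\<close>

text \<open>The argument \<open>TYPE('n)\<close> only carries the dimension \<open>CARD('n)\<close>. The half-space may be
  cut out by any coordinate, since all these half-spaces are isometric.\<close>

definition manifold_with_boundary :: "'n::finite itself \<Rightarrow> 'a topology \<Rightarrow> bool" where
  "manifold_with_boundary _ T \<longleftrightarrow>
     Hausdorff_space T \<and> second_countable T \<and>
     (\<forall>p\<in>topspace T. \<exists>U (k::'n) V. openin T U \<and> p \<in> U \<and>
        openin (top_of_set {x :: real ^ 'n. 0 \<le> x $ k}) V \<and>
        subtopology T U homeomorphic_space top_of_set V)"

definition manifold_interior :: "'n::finite itself \<Rightarrow> 'a topology \<Rightarrow> 'a set" where
  "manifold_interior _ T =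
     {p \<in> topspace T. \<exists>U (V :: (real ^ 'n) set). openin T U \<and> p \<in> U \<and> open V \<and>
        subtopology T U homeomorphic_space top_of_set V}"

definition manifold_boundary :: "'n::finite itself \<Rightarrow> 'a topology \<Rightarrow> 'a set" where
  "manifold_boundary n T = topspace T - manifold_interior n T"

definition Int_sub :: "'n::finite itself \<Rightarrow> 'a topology \<Rightarrow> 'a set \<Rightarrow> 'a set" where
  "Int_sub n X Y = manifold_interior n (subtopology X Y)"

definition bd_sub :: "'n::finite itself \<Rightarrow> 'a topology \<Rightarrow> 'a set \<Rightarrow> 'a set" where
  "bd_sub n X Y = manifold_boundary n (subtopology X Y)"

definition compact_connected_C0_submanifold :: "'n::finite itself \<Rightarrow> 'a topology \<Rightarrow> 'a set \<Rightarrow> bool" where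
  "compact_connected_C0_submanifold n X Y \<longleftrightarrow>
     Y \<subseteq> topspace X \<and> manifold_with_boundary n (subtopology X Y) \<and>
     compactin X Y \<and> connectedin X Y"


section \<open>The intrinsic metric of a submanifold\<close>

definition rho ::
    "'a topology \<Rightarrow> ('a, 'n::finite) chart set \<Rightarrow> ('a, 'n) metric_tensor \<Rightarrow> 'a set \<Rightarrow> 'a \<Rightarrow> 'a \<Rightarrow> ereal" where
  "rho X A g Y x y =
     (let I = principal (Int_sub TYPE('n) X Y)
      in Liminf (inf (nhdsin X x) I \<times>\<^sub>F inf (nhdsin X y) I)
           (\<lambda>(x', y'). inf_len X A g (Int_sub TYPE('n) X Y) x' y'))"

definition shortest_path ::
    "'a topology \<Rightarrow> ('a, 'n::finite) chart set \<Rightarrow> ('a, 'n) metric_tensor \<Rightarrow> 'a set \<Rightarrow>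
     'a \<Rightarrow> 'a \<Rightarrow> (real \<Rightarrow> 'a) \<Rightarrow> bool" where
  "shortest_path X A g Y \<alpha> \<beta> \<gamma> \<longleftrightarrow>
     \<alpha> \<in> Y \<and> \<beta> \<in> Y \<and> \<alpha> \<noteq> \<beta> \<and> pathin (subtopology X Y) \<gamma> \<and> \<gamma> 0 = \<alpha> \<and> \<gamma> 1 = \<beta> \<and>
     (\<exists>\<phi> :: real \<Rightarrow> real. strict_mono_on {0..1} \<phi> \<and> continuous_on {0..1} \<phi> \<and>
        \<phi> ` {0..1} \<subseteq> {0..} \<and> \<phi> 0 = 0 \<and>
        (\<forall>s t. 0 \<le> s \<and> s \<le> t \<and> t \<le> 1 \<longrightarrow> rho X A g Y (\<gamma> s) (\<gamma> t) = ereal (\<phi> t - \<phi> s)))"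

definition strictly_convex ::
    "'a topology \<Rightarrow> ('a, 'n::finite) chart set \<Rightarrow> ('a, 'n) metric_tensor \<Rightarrow> 'a set \<Rightarrow> bool" where
  "strictly_convex X A g Y \<longleftrightarrow>
     (\<forall>\<alpha>\<in>Y. \<forall>\<beta>\<in>Y. \<forall>\<gamma>. shortest_path X A g Y \<alpha> \<beta> \<gamma> \<longrightarrow> \<gamma> ` {0<..<1} \<subseteq> Int_sub TYPE('n) X Y)"

definition cond_i ::
    "'a topology \<Rightarrow> ('a, 'n::finite) chart set \<Rightarrow> ('a, 'n) metric_tensor \<Rightarrow> 'a set \<Rightarrow> bool" where
  "cond_i X A g Y \<longleftrightarrow> (\<forall>x\<in>Y. \<forall>y\<in>Y. rho X A g Y x y < \<infinity>)"

text \<open>To be read together with finiteness, since \<^const>\<open>real_of_ereal\<close> maps \<open>\<infinity>\<close> to 0. The values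
  off \<open>Y\<close> are set to 0 because \<^locale>\<open>Metric_space\<close> demands symmetry and nonnegativity on the whole type.\<close>

definition cond_ii ::
    "'a topology \<Rightarrow> ('a, 'n::finite) chart set \<Rightarrow> ('a, 'n) metric_tensor \<Rightarrow> 'a set \<Rightarrow> bool" where
  "cond_ii X A g Y \<longleftrightarrow>
     Metric_space Y (\<lambda>x y. if x \<in> Y \<and> y \<in> Y then real_of_ereal (rho X A g Y x y) else 0)"

definition cond_iii ::
    "'a topology \<Rightarrow> ('a, 'n::finite) chart set \<Rightarrow> ('a, 'n) metric_tensor \<Rightarrow> 'a set \<Rightarrow> bool" where
  "cond_iii X A g Y \<longleftrightarrow>
     (\<forall>a\<in>Y. \<forall>b\<in>Y. \<exists>c\<in>bd_sub TYPE('n) X Y. \<exists>d\<in>bd_sub TYPE('n) X Y. \<exists>\<gamma>.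
        shortest_path X A g Y c d \<gamma> \<and> a \<in> \<gamma> ` {0..1} \<and> b \<in> \<gamma> ` {0..1})"

definition admissible ::
    "'a topology \<Rightarrow> ('a, 'n::finite) chart set \<Rightarrow> ('a, 'n) metric_tensor \<Rightarrow> 'a set \<Rightarrow> bool" where
  "admissible X A g Y \<longleftrightarrow>
     compact_connected_C0_submanifold TYPE('n) X Y \<and> bd_sub TYPE('n) X Y \<noteq> {} \<and>
     cond_i X A g Y \<and> cond_ii X A g Y \<and> cond_iii X A g Y"

definition isometric_wrt ::
    "'a set \<Rightarrow> ('a \<Rightarrow> 'a \<Rightarrow> ereal) \<Rightarrow> 'a set \<Rightarrow> ('a \<Rightarrow> 'a \<Rightarrow> ereal) \<Rightarrow> bool" where
  "isometric_wrt S d T e \<longleftrightarrow>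
     (\<exists>f. bij_betw f S T \<and> (\<forall>x\<in>S. \<forall>y\<in>S. e (f x) (f y) = d x y))"

end

theory Submission
  imports Defs
begin

text \<open>
  It suffices to show that \<open>Y2\<close> is strictly convex too, since then \<open>\<rho>\<^sub>X\<close> agrees with the
  intrinsic metrics on both boundaries. Otherwise a shortest path of \<open>Y2\<close> from \<open>\<alpha>\<close> to \<open>\<beta>\<close> meets the
  boundary at an intermediate point \<open>e\<close>. By (iii), \<open>\<alpha>\<close> and \<open>\<beta>\<close> lie on a shortest path between boundary
  points \<open>c\<close> and \<open>d\<close>, so \<open>e\<close> lies metrically strictly between \<open>c\<close> and \<open>d\<close>. The isometry
  carries this to three boundary points of \<open>Y1\<close>; as (iii) provides shortest paths in \<open>Y1\<close>
  between any two points, concatenating two of them gives a shortest path of \<open>Y1\<close> that meets the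
  boundary at an intermediate point, against strict convexity.
\<close>

section \<open>Nonnegativity of lengths and of intrinsic distances\<close>

lemma path_len_nonneg:
  fixes A :: "('a, 'n::finite) chart set"
  assumes "riemannian_manifold X A g" "smooth_path X A \<gamma>"
  shows "0 \<le> path_len A g \<gamma>"
proof -
  have "0 \<le> speed A g \<gamma> t" if t: "t \<in> {0..1}" for t
  proof -
    define c where "c = (SOME c. c \<in> A \<and> \<gamma> t \<in> fst c)"
    have "\<gamma> t \<in> topspace X"
      using assms(2) t by (auto simp: smooth_path_def pathin_def continuous_map_def Pi_iff)
    then have "\<exists>c. c \<in> A \<and> \<gamma> t \<in> fst c"
      using assms(1) unfolding riemannian_manifold_def smooth_manifold_def by blast
    then have c: "c \<in> A \<and> \<gamma> t \<in> fst c"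
      unfolding c_def by (rule someI_ex)
    then have bil: "bilinear (g c (\<gamma> t))" and pos: "\<And>v. v \<noteq> 0 \<Longrightarrow> g c (\<gamma> t) v v > 0"
      using assms(1) by (auto simp: riemannian_manifold_def riemannian_metric_def)
    have "0 \<le> g c (\<gamma> t) v v" for v
      using pos[of v] bilinear_lzero[OF bil, of v] by (cases "v = 0") auto
    then show ?thesis
      by (simp add: speed_def c_def[symmetric] Let_def)
  qed
  \<comment> \<open>A non-integrable speed has integral 0 by convention, so regularity of the speed
    never has to be established.\<close>
  then show ?thesis
    unfolding path_len_def by (cases "speed A g \<gamma> integrable_on {0..1}")
      (auto intro: integral_nonneg simp: not_integrable_integral)
qed

text \<open>Excludes the value \<open>-\<infinity>\<close>, so that condition (i) makes the distance
  a real number.\<close>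

lemma rho_nonneg:
  fixes A :: "('a, 'n::finite) chart set"
  assumes "riemannian_manifold X A g"
  shows "0 \<le> rho X A g Y x y"
proof -
  have "0 \<le> inf_len X A g S x' y'" for S x' y'
    unfolding inf_len_def by (intro INF_greatest) (auto intro: path_len_nonneg[OF assms])
  then show ?thesis
    unfolding rho_def Let_def by (intro Liminf_bounded always_eventually) (auto split: prod.split)
qed

section \<open>Geodesics in an abstract metric space\<close>

text \<open>Shortest paths without named endpoints and without a normalised \<open>\<phi>\<close>,
  of which only differences matter. \<open>T\<close> and \<open>d\<close> are independent data: for
  a submanifold they become the subspace topology and the real-valued intrinsic distance.\<close>

definition geodesic :: "'a topology \<Rightarrow> ('a \<Rightarrow> 'a \<Rightarrow> real) \<Rightarrow> (real \<Rightarrow> 'a) \<Rightarrow> bool" where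
  "geodesic T d \<gamma> \<longleftrightarrow> pathin T \<gamma> \<and>
     (\<exists>\<phi>. strict_mono_on {0..1} \<phi> \<and> continuous_on {0..1} \<phi> \<and>
        (\<forall>s t. 0 \<le> s \<and> s \<le> t \<and> t \<le> 1 \<longrightarrow> d (\<gamma> s) (\<gamma> t) = \<phi> t - \<phi> s))"

lemma pathin_in_topspace: "pathin T \<gamma> \<Longrightarrow> t \<in> {0..1} \<Longrightarrow> \<gamma> t \<in> topspace T"
  by (auto simp: pathin_def continuous_map_def Pi_iff)

lemma pathin_compose:
  assumes "pathin T \<gamma>" "continuous_on {0..1} h" "h ` {0..1} \<subseteq> {0..1::real}"
  shows "pathin T (\<gamma> \<circ> h)"
  using assms unfolding pathin_def
  by (intro continuous_map_compose[where X' = "top_of_set {0..1}"]) auto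

text \<open>The library's \<open>+++\<close> is restricted to type class \<open>topological_space\<close>.\<close>

definition join_path :: "(real \<Rightarrow> 'a) \<Rightarrow> (real \<Rightarrow> 'a) \<Rightarrow> real \<Rightarrow> 'a" where
  "join_path \<gamma>1 \<gamma>2 t = (if t \<le> 1/2 then \<gamma>1 (2 * t) else \<gamma>2 (2 * t - 1))"

text \<open>Pasting over the two closed halves of \<open>[0,1]\<close>, which meet only in
  \<open>1/2\<close>, where the junction condition gives agreement.\<close>

lemma pathin_join:
  assumes "pathin T \<gamma>1" "pathin T \<gamma>2" "\<gamma>1 1 = \<gamma>2 0"
  shows "pathin T (join_path \<gamma>1 \<gamma>2)"
proof -
  let ?I = "top_of_set {0..1::real}"
  have half: "topspace ?I \<inter> {t. t \<le> 1/2} = {0..1/2}" "topspace ?I \<inter> {t. 1/2 \<le> t} = {1/2..1}"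
    by auto
  have "continuous_map ?I T (\<lambda>t. if t \<le> 1/2 then (\<gamma>1 \<circ> (\<lambda>t. 2 * t)) t else (\<gamma>2 \<circ> (\<lambda>t. 2 * t - 1)) t)"
  proof (rule continuous_map_cases_le)
    show "continuous_map (subtopology ?I {t \<in> topspace ?I. t \<le> 1/2}) T (\<gamma>1 \<circ> (\<lambda>t. 2 * t))"
      using assms(1) unfolding pathin_def
      by (intro continuous_map_compose[where X' = ?I])
         (auto simp: subtopology_subtopology intro!: continuous_intros)
    show "continuous_map (subtopology ?I {t \<in> topspace ?I. 1/2 \<le> t}) T (\<gamma>2 \<circ> (\<lambda>t. 2 * t - 1))"
      using assms(2) unfolding pathin_def
      by (intro continuous_map_compose[where X' = ?I])
         (auto simp: subtopology_subtopology intro!: continuous_intros)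
  qed (use assms(3) in \<open>auto simp: mult.commute\<close>)
  then show ?thesis
    unfolding pathin_def join_path_def[abs_def] o_def .
qed

context Metric_space
begin

lemma geodesic_between:
  assumes "geodesic T d \<gamma>" "topspace T = M" "0 \<le> r" "r \<le> s" "s \<le> t" "t \<le> 1"
  shows "d (\<gamma> r) (\<gamma> t) = d (\<gamma> r) (\<gamma> s) + d (\<gamma> s) (\<gamma> t)"
proof -
  obtain \<phi> where \<phi>: "\<And>s t. 0 \<le> s \<Longrightarrow> s \<le> t \<Longrightarrow> t \<le> 1 \<Longrightarrow> d (\<gamma> s) (\<gamma> t) = \<phi> t - \<phi> s"
    using assms(1) unfolding geodesic_def by blast
  show ?thesis
    using \<phi>[of r s] \<phi>[of s t] \<phi>[of r t] assms by linarith
qed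

lemma geodesic_inj:
  assumes "geodesic T d \<gamma>" "topspace T = M" "0 \<le> s" "s < t" "t \<le> 1"
  shows "\<gamma> s \<noteq> \<gamma> t"
proof
  assume eq: "\<gamma> s = \<gamma> t"
  obtain \<phi> where \<phi>: "strict_mono_on {0..1} \<phi>" "d (\<gamma> s) (\<gamma> t) = \<phi> t - \<phi> s"
    using assms(1,3-5) unfolding geodesic_def by (meson less_imp_le)
  have "\<gamma> t \<in> M"
    using assms pathin_in_topspace[of T \<gamma> t] unfolding geodesic_def by auto
  moreover have "\<phi> s < \<phi> t"
    using \<phi>(1) assms by (auto simp: strict_mono_on_def)
  ultimately show False
    using \<phi>(2) eq by simp
qed

text \<open>The case \<open>s < r\<close> is included, so this also reverses geodesics, which
  symmetry of \<open>d\<close> permits.\<close>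

lemma geodesic_subpath:
  assumes "geodesic T d \<gamma>" "topspace T = M" "r \<in> {0..1}" "s \<in> {0..1}" "r \<noteq> s"
  shows "geodesic T d (\<lambda>t. \<gamma> (r + t * (s - r)))"
proof -
  define h where "h = (\<lambda>t. r + t * (s - r))"
  obtain \<phi> where \<phi>: "strict_mono_on {0..1} \<phi>" "continuous_on {0..1} \<phi>"
    "\<And>s t. 0 \<le> s \<Longrightarrow> s \<le> t \<Longrightarrow> t \<le> 1 \<Longrightarrow> d (\<gamma> s) (\<gamma> t) = \<phi> t - \<phi> s"
    using assms(1) unfolding geodesic_def by blast
  have h_in: "h t \<in> {0..1}" if "t \<in> {0..1}" for t
  proof -
    have "h t = (1 - t) * r + t * s" by (simp add: h_def algebra_simps)
    moreover have "(1 - t) * r + t * s \<le> (1 - t) * 1 + t * 1"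
      using that assms(3,4) by (intro add_mono mult_left_mono) auto
    moreover have "0 \<le> (1 - t) * r + t * s"
      using that assms(3,4) by auto
    ultimately show ?thesis by simp
  qed
  have cont_h: "continuous_on {0..1} h"
    unfolding h_def by (intro continuous_intros)
  have "pathin T (\<gamma> \<circ> h)"
    using assms(1) h_in cont_h by (intro pathin_compose) (auto simp: geodesic_def)
  moreover have "\<exists>\<psi>. strict_mono_on {0..1} \<psi> \<and> continuous_on {0..1} \<psi> \<and>
        (\<forall>u v. 0 \<le> u \<and> u \<le> v \<and> v \<le> 1 \<longrightarrow> d (\<gamma> (h u)) (\<gamma> (h v)) = \<psi> v - \<psi> u)"
  proof (intro exI conjI allI impI)
    \<comment> \<open>The sign makes \<open>\<psi>\<close> increasing even when \<open>h\<close>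
      runs backwards.\<close>
    define \<psi> where "\<psi> = (\<lambda>t. sgn (s - r) * \<phi> (h t))"
    show "continuous_on {0..1} \<psi>"
      unfolding \<psi>_def using h_in
      by (intro continuous_intros continuous_on_compose2[OF \<phi>(2) cont_h]) auto
    show "strict_mono_on {0..1} \<psi>"
    proof (rule strict_mono_onI)
      fix u v :: real assume uv: "u \<in> {0..1}" "v \<in> {0..1}" "u < v"
      show "\<psi> u < \<psi> v"
      proof (cases "r < s")
        case True
        then have "h u < h v" using uv by (simp add: h_def)
        then show ?thesis
          using \<phi>(1) h_in uv True by (simp add: \<psi>_def strict_mono_on_def)
      next
        case False
        then have "h v < h u" using uv assms(5) by (simp add: h_def mult_less_cancel_right)
        then show ?thesis
          using \<phi>(1) h_in uv False assms(5) by (simp add: \<psi>_def strict_mono_on_def)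
      qed
    qed
    fix u v :: real assume uv: "0 \<le> u \<and> u \<le> v \<and> v \<le> 1"
    show "d (\<gamma> (h u)) (\<gamma> (h v)) = \<psi> v - \<psi> u"
    proof (cases "r < s")
      case True
      then have "h u \<le> h v" using uv by (simp add: h_def mult_right_mono)
      then show ?thesis
        using \<phi>(3)[of "h u" "h v"] h_in[of u] h_in[of v] uv True by (simp add: \<psi>_def)
    next
      case False
      then have "h v \<le> h u" using uv by (simp add: h_def mult_right_mono_neg)
      then show ?thesis
        using \<phi>(3)[of "h v" "h u"] h_in[of u] h_in[of v] uv False assms(5)
        by (simp add: \<psi>_def commute)
    qed
  qed
  ultimately show ?thesis
    by (simp add: geodesic_def o_def h_def)
qed

text \<open>Equality in the triangle inequality at the junction, for the outer endpoints, forces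
  equality for every pair of points on opposite sides of it: otherwise the route through such a pair
  would be shorter than the distance of the endpoints.\<close>

lemma geodesic_join:
  assumes geo: "geodesic T d \<gamma>1" "geodesic T d \<gamma>2" and top: "topspace T = M"
    and join: "\<gamma>1 1 = \<gamma>2 0"
    and between: "d (\<gamma>1 0) (\<gamma>2 1) = d (\<gamma>1 0) (\<gamma>1 1) + d (\<gamma>2 0) (\<gamma>2 1)"
  shows "geodesic T d (join_path \<gamma>1 \<gamma>2)"
proof -
  obtain \<phi>1 where \<phi>1: "strict_mono_on {0..1} \<phi>1" "continuous_on {0..1} \<phi>1"
    "\<And>s t. 0 \<le> s \<Longrightarrow> s \<le> t \<Longrightarrow> t \<le> 1 \<Longrightarrow> d (\<gamma>1 s) (\<gamma>1 t) = \<phi>1 t - \<phi>1 s"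
    using geo(1) unfolding geodesic_def by blast
  obtain \<phi>2 where \<phi>2: "strict_mono_on {0..1} \<phi>2" "continuous_on {0..1} \<phi>2"
    "\<And>s t. 0 \<le> s \<Longrightarrow> s \<le> t \<Longrightarrow> t \<le> 1 \<Longrightarrow> d (\<gamma>2 s) (\<gamma>2 t) = \<phi>2 t - \<phi>2 s"
    using geo(2) unfolding geodesic_def by blast
  have inM: "\<gamma>1 t \<in> M" "\<gamma>2 t \<in> M" if "t \<in> {0..1}" for t
    using geo pathin_in_topspace[OF _ that, of T] unfolding geodesic_def top by blast+
  \<comment> \<open>The shift starts the second length function at \<open>\<phi>1 1\<close>, so the
    branches agree at \<open>1/2\<close>. As \<open>\<psi>\<close> is real-valued,
    \<open>path_join_imp\<close> gives its continuity.\<close>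
  define \<psi> where "\<psi> = \<phi>1 +++ (\<lambda>t. \<phi>1 1 - \<phi>2 0 + \<phi>2 t)"
  have \<psi>_left: "\<psi> t = \<phi>1 (2 * t)" if "t \<le> 1/2" for t
    using that by (simp add: \<psi>_def joinpaths_def)
  \<comment> \<open>Both branch formulas hold at \<open>1/2\<close> itself, so values on opposite
    sides can be compared through the midpoint.\<close>
  have \<psi>_right: "\<psi> t = \<phi>1 1 - \<phi>2 0 + \<phi>2 (2 * t - 1)" if "1/2 \<le> t" for t
  proof (cases "t = 1/2")
    case True
    show ?thesis unfolding True by (simp add: \<psi>_def joinpaths_def)
  qed (use that in \<open>simp add: \<psi>_def joinpaths_def\<close>)
  have \<gamma>_left: "(join_path \<gamma>1 \<gamma>2) t = \<gamma>1 (2 * t)" if "t \<le> 1/2" for t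
    using that by (simp add: join_path_def)
  have \<gamma>_right: "(join_path \<gamma>1 \<gamma>2) t = \<gamma>2 (2 * t - 1)" if "1/2 \<le> t" for t
  proof (cases "t = 1/2")
    case True
    show ?thesis unfolding True by (simp add: join_path_def join)
  qed (use that in \<open>simp add: join_path_def\<close>)
  have "path \<psi>"
    unfolding \<psi>_def using \<phi>1(2) \<phi>2(2)
    by (intro path_join_imp) (auto simp: path_def pathfinish_def pathstart_def intro!: continuous_intros)
  then have cont: "continuous_on {0..1} \<psi>"
    by (simp add: path_def)
  have less_left: "\<psi> u < \<psi> v" if "0 \<le> u" "u < v" "v \<le> 1/2" for u v
    using that \<phi>1(1) by (simp add: \<psi>_left strict_mono_on_def)
  have less_right: "\<psi> u < \<psi> v" if "1/2 \<le> u" "u < v" "v \<le> 1" for u v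
    using that \<phi>2(1) by (simp add: \<psi>_right strict_mono_on_def)
  have mono: "strict_mono_on {0..1} \<psi>"
  proof (rule strict_mono_onI)
    fix u v :: real assume uv: "u \<in> {0..1}" "v \<in> {0..1}" "u < v"
    consider "v \<le> 1/2" | "1/2 \<le> u" | "u < 1/2" "1/2 < v" by linarith
    then show "\<psi> u < \<psi> v"
    proof cases
      case 3
      then have "\<psi> u < \<psi> (1/2)" "\<psi> (1/2) < \<psi> v"
        using uv by (auto intro: less_left less_right)
      then show ?thesis by simp
    qed (use uv in \<open>auto intro: less_left less_right\<close>)
  qed
  have dist: "d ((join_path \<gamma>1 \<gamma>2) u) ((join_path \<gamma>1 \<gamma>2) v) = \<psi> v - \<psi> u" if uv: "0 \<le> u" "u \<le> v" "v \<le> 1" for u v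
  proof -
    consider "v \<le> 1/2" | "1/2 \<le> u" | "u < 1/2" "1/2 < v" by linarith
    then show ?thesis
    proof cases
      case 1
      then show ?thesis using uv by (simp add: \<gamma>_left \<psi>_left \<phi>1(3))
    next
      case 2
      then show ?thesis using uv by (simp add: \<gamma>_right \<psi>_right \<phi>2(3))
    next
      case 3
      let ?p = "\<gamma>1 (2 * u)" and ?q = "\<gamma>2 (2 * v - 1)"
      have in_M: "?p \<in> M" "?q \<in> M" "\<gamma>1 0 \<in> M" "\<gamma>2 0 \<in> M" "\<gamma>2 1 \<in> M"
        using 3 uv by (auto intro: inM)
      \<comment> \<open>The junction has two names: the first \<open>auto\<close> rewrites it to
        \<open>\<gamma>1 1\<close> for the pieces on the first path, the second to
        \<open>\<gamma>2 0\<close> for the others.\<close>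
      have pieces: "d (\<gamma>1 0) ?p = \<phi>1 (2 * u) - \<phi>1 0" "d ?p (\<gamma>2 0) = \<phi>1 1 - \<phi>1 (2 * u)"
        "d (\<gamma>2 0) ?q = \<phi>2 (2 * v - 1) - \<phi>2 0" "d ?q (\<gamma>2 1) = \<phi>2 1 - \<phi>2 (2 * v - 1)"
        using 3 uv by (auto simp flip: join simp: \<phi>1(3)) (auto simp: join \<phi>2(3))
      have whole: "d (\<gamma>1 0) (\<gamma>2 1) = \<phi>1 1 - \<phi>1 0 + (\<phi>2 1 - \<phi>2 0)"
        using between by (simp add: \<phi>1(3) \<phi>2(3))
      \<comment> \<open>The junction gives an upper bound for \<open>d ?p ?q\<close>; the inequality
        after it, with the outer pieces subtracted, gives the same value as a lower bound.\<close>
      have "d ?p ?q \<le> d ?p (\<gamma>2 0) + d (\<gamma>2 0) ?q"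
        using in_M by (intro triangle)
      moreover have "d (\<gamma>1 0) (\<gamma>2 1) \<le> d (\<gamma>1 0) ?p + d ?p ?q + d ?q (\<gamma>2 1)"
        using in_M triangle[of "\<gamma>1 0" ?p "\<gamma>2 1"] triangle[of ?p ?q "\<gamma>2 1"] by linarith
      ultimately have "d ?p ?q = \<phi>1 1 - \<phi>1 (2 * u) + (\<phi>2 (2 * v - 1) - \<phi>2 0)"
        using pieces whole by linarith
      then show ?thesis
        using 3 by (simp add: \<gamma>_left \<gamma>_right \<psi>_left \<psi>_right)
    qed
  qed
  have "pathin T (join_path \<gamma>1 \<gamma>2)"
    using geo join by (intro pathin_join) (auto simp: geodesic_def)
  then show ?thesis
    unfolding geodesic_def using mono cont dist by blast
qed

text \<open>Triangle inequalities through \<open>\<alpha>\<close> and \<open>\<beta>\<close> bound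
  \<open>d c e + d e d'\<close> by \<open>d c d'\<close>; the reverse bound is the triangle
  inequality at \<open>e\<close>. Since \<open>c\<close> and \<open>d'\<close> may coincide with
  \<open>\<alpha>\<close> and \<open>\<beta>\<close>, strictness has to come from \<open>e\<close>
  being distinct from the latter two.\<close>

lemma between_insert:
  assumes "c \<in> M" "\<alpha> \<in> M" "e \<in> M" "\<beta> \<in> M" "d' \<in> M"
    and "d c d' = d c \<alpha> + d \<alpha> \<beta> + d \<beta> d'" "d \<alpha> \<beta> = d \<alpha> e + d e \<beta>" "e \<noteq> \<alpha>" "e \<noteq> \<beta>"
  shows "d c d' = d c e + d e d'" "e \<noteq> c" "e \<noteq> d'"
proof -
  have tri: "d c e \<le> d c \<alpha> + d \<alpha> e" "d e d' \<le> d e \<beta> + d \<beta> d'" "d c d' \<le> d c e + d e d'"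
    using assms(1-5) by (auto intro: triangle)
  then show "d c d' = d c e + d e d'" using assms by linarith
  have "0 < d \<alpha> e" "0 < d e \<beta>" using assms by auto
  \<comment> \<open>With \<open>e = c\<close> the first inequality, and with \<open>e = d'\<close>
    the second, would read \<open>d c d' < d c d'\<close>.\<close>
  have "d e d' < d c d'" "d c e < d c d'"
    using tri(1,2) assms(6,7) \<open>0 < d \<alpha> e\<close> \<open>0 < d e \<beta>\<close> nonneg[of c \<alpha>] nonneg[of \<beta> d'] by linarith+
  then show "e \<noteq> c" "e \<noteq> d'" by auto
qed

end

section \<open>Strict convexity in terms of boundary distances\<close>

text \<open>The distance function of \<open>cond_ii\<close>, named so that the results in
  \<open>Metric_space\<close> apply to it.\<close>

definition rho_real ::
    "'a topology \<Rightarrow> ('a, 'n::finite) chart set \<Rightarrow> ('a, 'n) metric_tensor \<Rightarrow> 'a set \<Rightarrow> 'a \<Rightarrow> 'a \<Rightarrow> real" where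
  "rho_real X A g Y x y = (if x \<in> Y \<and> y \<in> Y then real_of_ereal (rho X A g Y x y) else 0)"

context
  fixes X :: "'a topology" and A :: "('a, 'n::finite) chart set" and g :: "('a, 'n) metric_tensor"
    and Y :: "'a set"
  assumes riem: "riemannian_manifold X A g" and adm: "admissible X A g Y"
begin

lemma rho_eq_rho_real: "x \<in> Y \<Longrightarrow> y \<in> Y \<Longrightarrow> rho X A g Y x y = ereal (rho_real X A g Y x y)"
  using adm rho_nonneg[OF riem, of Y x y] unfolding admissible_def cond_i_def rho_real_def
  by (cases "rho X A g Y x y") auto

lemma Metric_space_rho_real: "Metric_space Y (rho_real X A g Y)"
  using adm unfolding admissible_def cond_ii_def rho_real_def by simp

lemma topspace_subtopology_admissible: "topspace (subtopology X Y) = Y"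
  using adm by (auto simp: admissible_def compact_connected_C0_submanifold_def)

lemma bd_sub_subset: "bd_sub TYPE('n) X Y \<subseteq> Y"
  unfolding bd_sub_def manifold_boundary_def topspace_subtopology_admissible by blast

lemma Int_sub_eq: "Int_sub TYPE('n) X Y = Y - bd_sub TYPE('n) X Y"
  unfolding Int_sub_def bd_sub_def manifold_boundary_def
  using topspace_subtopology_admissible by (auto simp: manifold_interior_def)

text \<open>The other requirements on a shortest path come for free: its endpoints lie in
  \<open>Y\<close> as values of the path, and they differ because a geodesic is injective.\<close>

lemma shortest_path_iff_geodesic:
  "shortest_path X A g Y \<alpha> \<beta> \<gamma> \<longleftrightarrow>
     geodesic (subtopology X Y) (rho_real X A g Y) \<gamma> \<and> \<gamma> 0 = \<alpha> \<and> \<gamma> 1 = \<beta>"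
  (is "?L \<longleftrightarrow> ?R")
proof
  assume ?L
  then obtain \<phi> where p: "pathin (subtopology X Y) \<gamma>"
    and \<phi>: "strict_mono_on {0..1} \<phi>" "continuous_on {0..1} \<phi>"
      "\<And>s t. 0 \<le> s \<Longrightarrow> s \<le> t \<Longrightarrow> t \<le> 1 \<Longrightarrow> rho X A g Y (\<gamma> s) (\<gamma> t) = ereal (\<phi> t - \<phi> s)"
    unfolding shortest_path_def by blast
  have inY: "\<gamma> t \<in> Y" if "t \<in> {0..1}" for t
    using pathin_in_topspace[OF p that] by auto
  have "rho_real X A g Y (\<gamma> s) (\<gamma> t) = \<phi> t - \<phi> s" if "0 \<le> s" "s \<le> t" "t \<le> 1" for s t
    using \<phi>(3)[OF that] inY[of s] inY[of t] that by (simp add: rho_real_def)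
  then show ?R
    using p \<phi>(1,2) \<open>?L\<close> by (auto simp: geodesic_def shortest_path_def)
next
  assume R: ?R
  then obtain \<phi> where p: "pathin (subtopology X Y) \<gamma>"
    and \<phi>: "strict_mono_on {0..1} \<phi>" "continuous_on {0..1} \<phi>"
      "\<And>s t. 0 \<le> s \<Longrightarrow> s \<le> t \<Longrightarrow> t \<le> 1 \<Longrightarrow> rho_real X A g Y (\<gamma> s) (\<gamma> t) = \<phi> t - \<phi> s"
    unfolding geodesic_def by blast
  have inY: "\<gamma> t \<in> Y" if "t \<in> {0..1}" for t
    using pathin_in_topspace[OF p that] by auto
  have ne: "\<gamma> 0 \<noteq> \<gamma> 1"
    using Metric_space.geodesic_inj[OF Metric_space_rho_real _ topspace_subtopology_admissible] R
    by (metis order_refl zero_less_one)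
  \<comment> \<open>Restores the normalisation at 0; monotonicity then makes all values
    nonnegative.\<close>
  define \<psi> where "\<psi> = (\<lambda>t. \<phi> t - \<phi> 0)"
  have "strict_mono_on {0..1} \<psi>" "continuous_on {0..1} \<psi>" "\<psi> 0 = 0"
    using \<phi>(1,2) by (auto simp: \<psi>_def strict_mono_on_def intro!: continuous_intros)
  moreover have "\<psi> ` {0..1} \<subseteq> {0..}"
    using strict_mono_on_leD[OF \<phi>(1), of 0] by (auto simp: \<psi>_def)
  moreover have "rho X A g Y (\<gamma> s) (\<gamma> t) = ereal (\<psi> t - \<psi> s)" if "0 \<le> s \<and> s \<le> t \<and> t \<le> 1" for s t
    using \<phi>(3)[of s t] inY[of s] inY[of t] that by (simp add: rho_eq_rho_real \<psi>_def)
  ultimately have "\<exists>\<phi> :: real \<Rightarrow> real. strict_mono_on {0..1} \<phi> \<and> continuous_on {0..1} \<phi> \<and>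
      \<phi> ` {0..1} \<subseteq> {0..} \<and> \<phi> 0 = 0 \<and>
      (\<forall>s t. 0 \<le> s \<and> s \<le> t \<and> t \<le> 1 \<longrightarrow> rho X A g Y (\<gamma> s) (\<gamma> t) = ereal (\<phi> t - \<phi> s))"
    by blast
  then show ?L
    using R p ne inY[of 0] inY[of 1] by (auto simp: shortest_path_def)
qed

text \<open>Condition (iii) puts both points on one shortest path, and the piece between them is cut
  out, run backwards if \<open>b\<close> comes first.\<close>

lemma exists_geodesic:
  assumes "a \<in> Y" "b \<in> Y" "a \<noteq> b"
  shows "\<exists>\<gamma>. geodesic (subtopology X Y) (rho_real X A g Y) \<gamma> \<and> \<gamma> 0 = a \<and> \<gamma> 1 = b"
proof -
  obtain c d \<sigma> where "shortest_path X A g Y c d \<sigma>" and on: "a \<in> \<sigma> ` {0..1}" "b \<in> \<sigma> ` {0..1}"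
    using adm assms unfolding admissible_def cond_iii_def by blast
  then have \<sigma>: "geodesic (subtopology X Y) (rho_real X A g Y) \<sigma>"
    by (simp add: shortest_path_iff_geodesic)
  from on obtain r s where rs: "r \<in> {0..1}" "s \<in> {0..1}" "a = \<sigma> r" "b = \<sigma> s" by blast
  have "geodesic (subtopology X Y) (rho_real X A g Y) (\<lambda>t. \<sigma> (r + t * (s - r)))"
    using rs assms(3) \<sigma>
    by (intro Metric_space.geodesic_subpath[OF Metric_space_rho_real _ topspace_subtopology_admissible])
       auto
  then show ?thesis
    using rs by (intro exI[of _ "\<lambda>t. \<sigma> (r + t * (s - r))"]) auto
qed

text \<open>The right-hand side speaks only of distances between boundary points, so an isometry of
  the boundaries can carry it from one submanifold to the other.\<close>

lemma strictly_convex_iff_boundary: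
  "strictly_convex X A g Y \<longleftrightarrow>
     (\<forall>c\<in>bd_sub TYPE('n) X Y. \<forall>e\<in>bd_sub TYPE('n) X Y. \<forall>d\<in>bd_sub TYPE('n) X Y.
        rho X A g Y c d = rho X A g Y c e + rho X A g Y e d \<longrightarrow> e = c \<or> e = d)"
  (is "?L \<longleftrightarrow> ?R")
proof
  interpret Metric_space Y "rho_real X A g Y" by (rule Metric_space_rho_real)
  note top = topspace_subtopology_admissible
  show ?R if ?L
  proof (intro ballI impI, rule ccontr)
    fix c e d
    assume bd: "c \<in> bd_sub TYPE('n) X Y" "e \<in> bd_sub TYPE('n) X Y" "d \<in> bd_sub TYPE('n) X Y"
      and eq: "rho X A g Y c d = rho X A g Y c e + rho X A g Y e d" and ne: "\<not> (e = c \<or> e = d)"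
    have inY: "c \<in> Y" "e \<in> Y" "d \<in> Y" using bd bd_sub_subset by auto
    obtain \<gamma>1 where \<gamma>1: "geodesic (subtopology X Y) (rho_real X A g Y) \<gamma>1" "\<gamma>1 0 = c" "\<gamma>1 1 = e"
      using exists_geodesic[of c e] inY ne by auto
    obtain \<gamma>2 where \<gamma>2: "geodesic (subtopology X Y) (rho_real X A g Y) \<gamma>2" "\<gamma>2 0 = e" "\<gamma>2 1 = d"
      using exists_geodesic[of e d] inY ne by auto
    \<comment> \<open>The assumed equation, read in the reals, is the additivity required at the
      junction \<open>e\<close>.\<close>
    have "geodesic (subtopology X Y) (rho_real X A g Y) (join_path \<gamma>1 \<gamma>2)"
      using \<gamma>1 \<gamma>2 eq inY by (intro geodesic_join[OF _ _ top]) (auto simp: rho_eq_rho_real)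
    moreover have "(join_path \<gamma>1 \<gamma>2) 0 = c" "(join_path \<gamma>1 \<gamma>2) 1 = d" "(join_path \<gamma>1 \<gamma>2) (1/2) = e"
      using \<gamma>1 \<gamma>2 by (auto simp: join_path_def)
    ultimately have "shortest_path X A g Y c d (join_path \<gamma>1 \<gamma>2)"
      by (simp add: shortest_path_iff_geodesic)
    then have "(join_path \<gamma>1 \<gamma>2) ` {0<..<1} \<subseteq> Int_sub TYPE('n) X Y"
      using that inY unfolding strictly_convex_def by blast
    moreover have "e \<in> (join_path \<gamma>1 \<gamma>2) ` {0<..<1}"
      using \<open>(join_path \<gamma>1 \<gamma>2) (1/2) = e\<close> by (intro image_eqI[of _ _ "1/2"]) auto
    ultimately show False
      using bd by (auto simp: Int_sub_eq)
  qed
  show ?L if R: ?R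
    unfolding strictly_convex_def
  proof (intro ballI allI impI subsetI, rule ccontr)
    fix \<alpha> \<beta> \<gamma> e
    assume \<alpha>\<beta>: "\<alpha> \<in> Y" "\<beta> \<in> Y" and "shortest_path X A g Y \<alpha> \<beta> \<gamma>" and e: "e \<in> \<gamma> ` {0<..<1}"
      and "e \<notin> Int_sub TYPE('n) X Y"
    then have \<gamma>: "geodesic (subtopology X Y) (rho_real X A g Y) \<gamma>" "\<gamma> 0 = \<alpha>" "\<gamma> 1 = \<beta>"
      by (auto simp: shortest_path_iff_geodesic)
    obtain t where t: "0 < t" "t < 1" "e = \<gamma> t" using e by auto
    have eY: "e \<in> Y"
      using pathin_in_topspace[of "subtopology X Y" \<gamma> t] \<gamma>(1) t by (auto simp: geodesic_def)
    then have ebd: "e \<in> bd_sub TYPE('n) X Y"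
      using \<open>e \<notin> Int_sub TYPE('n) X Y\<close> by (auto simp: Int_sub_eq)
    have ne: "e \<noteq> \<alpha>" "e \<noteq> \<beta>"
      using geodesic_inj[OF \<gamma>(1) top, of 0 t] geodesic_inj[OF \<gamma>(1) top, of t 1] \<gamma> t by auto
    have btw: "rho_real X A g Y \<alpha> \<beta> = rho_real X A g Y \<alpha> e + rho_real X A g Y e \<beta>"
      using geodesic_between[OF \<gamma>(1) top, of 0 t 1] \<gamma> t by simp
    obtain c d \<sigma> where cd: "c \<in> bd_sub TYPE('n) X Y" "d \<in> bd_sub TYPE('n) X Y"
      and "shortest_path X A g Y c d \<sigma>" and on: "\<alpha> \<in> \<sigma> ` {0..1}" "\<beta> \<in> \<sigma> ` {0..1}"
      using adm \<alpha>\<beta> unfolding admissible_def cond_iii_def by blast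
    then have \<sigma>: "geodesic (subtopology X Y) (rho_real X A g Y) \<sigma>" "\<sigma> 0 = c" "\<sigma> 1 = d"
      by (auto simp: shortest_path_iff_geodesic)
    have cdY: "c \<in> Y" "d \<in> Y" using cd bd_sub_subset by auto
    obtain r s where rs: "0 \<le> r" "r \<le> 1" "0 \<le> s" "s \<le> 1" "\<alpha> = \<sigma> r" "\<beta> = \<sigma> s" using on by auto
    \<comment> \<open>\<open>\<sigma>\<close> may pass \<open>\<alpha>\<close> and
      \<open>\<beta>\<close> in either order. Splitting it at the earlier and then at the later
      parameter gives the chain of distances for \<open>between_insert\<close>.\<close>
    have "rho_real X A g Y c d = rho_real X A g Y c e + rho_real X A g Y e d \<and> e \<noteq> c \<and> e \<noteq> d"
    proof (cases "r \<le> s")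
      case True
      then have "rho_real X A g Y c d =
          rho_real X A g Y c \<alpha> + rho_real X A g Y \<alpha> \<beta> + rho_real X A g Y \<beta> d"
        using geodesic_between[OF \<sigma>(1) top, of 0 r 1] geodesic_between[OF \<sigma>(1) top, of r s 1] \<sigma> rs
        by simp
      from between_insert[OF _ _ _ _ _ this btw] show ?thesis
        using \<alpha>\<beta> eY cdY ne by simp
    next
      case False
      then have "rho_real X A g Y c d =
          rho_real X A g Y c \<beta> + rho_real X A g Y \<beta> \<alpha> + rho_real X A g Y \<alpha> d"
        using geodesic_between[OF \<sigma>(1) top, of 0 s 1] geodesic_between[OF \<sigma>(1) top, of s r 1] \<sigma> rs
        by simp
      moreover have "rho_real X A g Y \<beta> \<alpha> = rho_real X A g Y \<beta> e + rho_real X A g Y e \<alpha>"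
        using btw by (simp add: commute)
      ultimately show ?thesis
        using between_insert[of c \<beta> e \<alpha> d] \<alpha>\<beta> eY cdY ne by simp
    qed
    then show False
      using R[rule_format, of c e d] cd ebd cdY eY by (auto simp: rho_eq_rho_real)
  qed
qed

end

section \<open>Transfer of strict convexity along the isometry\<close>

theorem theorem3p2:
  fixes X :: "'a topology"
    and A :: "('a, 'n::finite) chart set"
    and g :: "('a, 'n) metric_tensor"
    and Y1 Y2 :: "'a set"
  assumes "CARD('n) \<ge> 3"
    and "riemannian_manifold X A g"
    and "connected_space X"
    and "admissible X A g Y1"
    and "admissible X A g Y2"
    and "strictly_convex X A g Y1"
    and "\<And>Y. admissible X A g Y \<Longrightarrow> strictly_convex X A g Y \<Longrightarrow>
           (\<forall>x\<in>Y. \<forall>y\<in>Y. rho_X X A g x y = rho X A g Y x y)"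
    and "isometric_wrt (bd_sub TYPE('n) X Y1) (rho X A g Y1) (bd_sub TYPE('n) X Y2) (rho X A g Y2)"
  shows "isometric_wrt (bd_sub TYPE('n) X Y1) (rho_X X A g) (bd_sub TYPE('n) X Y2) (rho_X X A g)"
proof -
  let ?B1 = "bd_sub TYPE('n) X Y1" and ?B2 = "bd_sub TYPE('n) X Y2"
  obtain f where f: "bij_betw f ?B1 ?B2"
    and iso: "\<And>x y. x \<in> ?B1 \<Longrightarrow> y \<in> ?B1 \<Longrightarrow> rho X A g Y2 (f x) (f y) = rho X A g Y1 x y"
    using assms(8) unfolding isometric_wrt_def by blast
  have f_image: "f ` ?B1 = ?B2" using f by (simp add: bij_betw_def)
  have "e = c \<or> e = d"
    if "c \<in> ?B1" "e \<in> ?B1" "d \<in> ?B1" "rho X A g Y1 c d = rho X A g Y1 c e + rho X A g Y1 e d"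
    for c e d
    using assms(6) that unfolding strictly_convex_iff_boundary[OF assms(2,4)] by blast
  \<comment> \<open>Every point of \<open>?B2\<close> is an image under \<open>f\<close>, so three
    boundary points of \<open>Y2\<close> with additive distances come from three such points of
    \<open>Y1\<close>; there the middle one equals an end, and hence so do the images.\<close>
  then have "strictly_convex X A g Y2"
    unfolding strictly_convex_iff_boundary[OF assms(2,5)] f_image[symmetric]
    by (auto simp: iso)
  then have rho2: "rho_X X A g x y = rho X A g Y2 x y" if "x \<in> Y2" "y \<in> Y2" for x y
    using assms(5,7) that by blast
  have rho1: "rho_X X A g x y = rho X A g Y1 x y" if "x \<in> Y1" "y \<in> Y1" for x y
    using assms(4,6,7) that by blast
  \<comment> \<open>The given \<open>f\<close> itself is the required bijection: on each boundary
    \<open>rho_X\<close> is the intrinsic distance, which \<open>f\<close> preserves.\<close>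
  have "rho_X X A g (f x) (f y) = rho_X X A g x y" if "x \<in> ?B1" "y \<in> ?B1" for x y
  proof -
    have "f x \<in> Y2" "f y \<in> Y2" "x \<in> Y1" "y \<in> Y1"
      using that f_image bd_sub_subset[OF assms(2,4)] bd_sub_subset[OF assms(2,5)] by auto
    then show ?thesis
      using iso[OF that] by (simp add: rho1 rho2)
  qed
  then show ?thesis
    unfolding isometric_wrt_def using f by blast
qed

end
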